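(* Let $\kappa_1,\kappa_2\in\mathbb{R}$ with $\kappa_1+4\kappa_2>0$ and let $T>0$. There exists a constant $C>0$, independent of $N$ and $t$, such that for every even integer $N\ge 4$, with $\varepsilon=1/N$, every $t$ with $0\le t\le T\varepsilon$ (the regime $t=\mathcal{O}(\varepsilon)$), and every $n\in\{1,\dots,N\}$ with $n\ne N/2$ and $n\ne N/2-1$, the discrete gradient $Dy$ of the solution $y$ of the lattice problem described in the context satisfies \[ |Dy(n,t)|\le C\frac{|\kappa_2|}{\kappa_1+4\kappa_2}\left(|n+1/2-N/2|^{-2/3}+\varepsilon^{2/3}\right). \]
   Context: Let $N$ be an even integer and $\varepsilon=1/N$. The function $y(n,t)$, $n\in\mathbb{Z}$, $t\ge 0$, is the solution, $N$-periodic in $n$, of \[ \ddot y(n,t)-\frac{\kappa_1+4\kappa_2}{\varepsilon^2}\bigl[y(n-1,t)-2y(n,t)+y(n+1,t)\bigr]=f(n),\qquad y(n,0)=0,\quad \dot y(n,0)=0, \] where dots denote $t$-derivatives and $f$ (the "ghost force") is the $N$-periodic function with $f(N/2)=2\kappa_2/\varepsilon$, $f(N/2-1)=f(N/2+1)=-\kappa_2/\varepsilon$, and $f(n)=0$ for all other $n\in\{1,\dots,N\}$. The discrete gradient is $Dy(n,t)=\bigl(y(n+1,t)-y(n,t)\bigr)/\varepsilon$. *)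

theory Defs
  imports Complex_Main
begin

text \<open>
  The lattice spacing is \<open>\<epsilon> = 1 / N\<close> throughout. Sites are integers, and \<open>N\<close>-periodicity
  is required on the whole of \<open>\<int>\<close>.
\<close>

definition spacing :: "nat \<Rightarrow> real" where
  "spacing N = 1 / real N"

text \<open>
  The ghost force is \<open>N\<close>-periodic by reduction modulo \<open>N\<close>. For even \<open>N \<ge> 4\<close> the sites
  \<open>N/2 - 1\<close>, \<open>N/2\<close>, \<open>N/2 + 1\<close> lie strictly between \<open>0\<close> and \<open>N\<close>, so each is its own residue,
  and the site \<open>N\<close>, with residue \<open>0\<close>, carries no force.
\<close>

definition ghost_force :: "real \<Rightarrow> nat \<Rightarrow> int \<Rightarrow> real" where
  "ghost_force \<kappa>\<^sub>2 N n =
     (let m = n mod int N; c = int N div 2 in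
      if m = c then 2 * \<kappa>\<^sub>2 / spacing N
      else if m = c - 1 \<or> m = c + 1 then - \<kappa>\<^sub>2 / spacing N
      else 0)"

text \<open>
  The functions \<open>v\<close> and \<open>a\<close> are the first and second time derivatives of \<open>y\<close>. Derivatives are
  taken within \<open>[0, \<infinity>)\<close>, so they are one-sided at \<open>t = 0\<close>, and values of \<open>y\<close> at negative times
  play no role.
\<close>

definition lattice_solution ::
    "real \<Rightarrow> real \<Rightarrow> nat \<Rightarrow> (int \<Rightarrow> real \<Rightarrow> real) \<Rightarrow> bool" where
  "lattice_solution \<kappa>\<^sub>1 \<kappa>\<^sub>2 N y \<longleftrightarrow>
     (\<forall>n. \<forall>t\<ge>0. y (n + int N) t = y n t) \<and>
     (\<exists>v a.
        (\<forall>n. \<forall>t\<ge>0. (y n has_real_derivative v n t) (at t within {0..})) \<and>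
        (\<forall>n. \<forall>t\<ge>0. (v n has_real_derivative a n t) (at t within {0..})) \<and>
        (\<forall>n. \<forall>t\<ge>0.
           a n t - (\<kappa>\<^sub>1 + 4 * \<kappa>\<^sub>2) / (spacing N)\<^sup>2 * (y (n - 1) t - 2 * y n t + y (n + 1) t)
             = ghost_force \<kappa>\<^sub>2 N n) \<and>
        (\<forall>n. y n 0 = 0) \<and>
        (\<forall>n. v n 0 = 0))"

definition discrete_gradient ::
    "nat \<Rightarrow> (int \<Rightarrow> real \<Rightarrow> real) \<Rightarrow> int \<Rightarrow> real \<Rightarrow> real" where
  "discrete_gradient N y n t = (y (n + 1) t - y n t) / spacing N"

end

theory Submission
  imports Defs
begin

text \<open>
  On the short time scale \<open>t \<le> T \<epsilon>\<close> the ghost force has no time to spread: in the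
  variable \<open>t / \<epsilon>\<close> the equation for \<open>z = y / \<epsilon>\<close> is a discrete wave equation with
  coefficients independent of \<open>N\<close>, observed up to the fixed time \<open>T\<close>, and driven by a force of
  size \<open>\<kappa>\<^sub>2\<close> on three sites next to \<open>c = N / 2\<close>.
  Decay away from \<open>c\<close> is then measured by a weighted energy,
  \<open>E(t) = (\<Sum>n = 1..N. (1 + (n - c)\<^sup>2) * (z(n,t)\<^sup>2 + v(n,t)\<^sup>2))\<close> with \<open>v\<close> the velocity.
  Since neighbouring weights are comparable, also across the periodic seam, the coupling to
  the neighbours costs only a constant factor, whence
  \<open>\<epsilon> E' \<le> K E + 8 \<kappa>\<^sub>2\<^sup>2\<close> with \<open>K = 2 + 8 (\<kappa>\<^sub>1 + 4 \<kappa>\<^sub>2)\<close>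
  (\<open>lattice_energy_derivative_bound\<close>). Gronwall's inequality gives
  \<open>E \<le> 8 \<kappa>\<^sub>2\<^sup>2 T exp (K T)\<close> for \<open>t \<le> T \<epsilon>\<close>, uniformly in \<open>N\<close>, and a single term of the sum gives
  \<open>\<bar>z(n,t)\<bar> = O(\<bar>\<kappa>\<^sub>2\<bar> / r)\<close> with \<open>r = \<bar>n + 1/2 - c\<bar>\<close>. The gradient is a difference of two
  such values, and \<open>1 / r = O(r powr (-2/3))\<close> because \<open>r \<ge> 1/2\<close>.
\<close>

section \<open>Gronwall's inequality\<close>

lemma linear_gronwall:
  fixes E E' :: "real \<Rightarrow> real"
  assumes deriv: "\<And>s. s \<ge> 0 \<Longrightarrow> (E has_real_derivative E' s) (at s within {0..})"
    and bound: "\<And>s. s \<ge> 0 \<Longrightarrow> E' s \<le> K * E s + G"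
    and "K \<ge> 0" "G \<ge> 0" "t \<ge> 0"
  shows "E t \<le> (E 0 + G * t) * exp (K * t)"
proof (cases "t = 0")
  case False
  then have "t > 0" using \<open>t \<ge> 0\<close> by simp
  \<comment> \<open>The integrating factor turns the bound into monotonicity; \<open>exp (- K s) \<le> 1\<close> lets the
     forcing be integrated as a constant.\<close>
  define g where "g s = exp (- (K * s)) * E s - G * s" for s
  define g' where "g' s = exp (- (K * s)) * (E' s - K * E s) - G" for s
  have g_deriv: "(g has_real_derivative g' s) (at s within {0..})" if "s \<ge> 0" for s
    unfolding g_def g'_def
    by (rule derivative_eq_intros deriv that refl | simp add: algebra_simps)+
  have g'_nonpos: "g' s \<le> 0" if "s \<ge> 0" for s
  proof -
    have "exp (- (K * s)) * (E' s - K * E s) \<le> exp (- (K * s)) * G"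
      using bound[OF that] by (intro mult_left_mono) auto
    also have "\<dots> \<le> G"
      using that \<open>K \<ge> 0\<close> \<open>G \<ge> 0\<close> by (intro mult_left_le_one_le) auto
    finally show ?thesis by (simp add: g'_def)
  qed
  have "g t \<le> g 0"
  proof (rule DERIV_nonpos_imp_decreasing_open[OF \<open>t \<ge> 0\<close>])
    fix s assume s: "0 < s" "s < t"
    have "at s within {0..} = at s"
      using s by (intro at_within_open_subset[of _ "{0<..}"]) auto
    then show "\<exists>y. DERIV g s :> y \<and> y \<le> 0"
      using g_deriv[of s] g'_nonpos[of s] s by auto
  next
    have "continuous_on {0..} g"
      using g_deriv by (intro DERIV_continuous_on) auto
    then show "continuous_on {0..t} g"
      by (rule continuous_on_subset) auto
  qed
  then have "exp (- (K * t)) * E t \<le> E 0 + G * t"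
    by (simp add: g_def)
  then have "exp (K * t) * (exp (- (K * t)) * E t) \<le> exp (K * t) * (E 0 + G * t)"
    by (intro mult_left_mono) auto
  then show ?thesis
    by (simp add: exp_minus field_simps)
qed simp

section \<open>A quadratic weight on one period\<close>

text \<open>
  The weight bounds a summand of the weighted energy pointwise by the inverse square of the
  distance to \<open>c\<close>, and it grows slowly enough that a unit shift changes it by a bounded factor.
\<close>

definition site_weight :: "int \<Rightarrow> int \<Rightarrow> real" where
  "site_weight c n = 1 + (real_of_int (n - c))\<^sup>2"

lemma site_weight_pos: "site_weight c n > 0"
  unfolding site_weight_def by (simp add: add_pos_nonneg)

lemma site_weight_neighbour:
  assumes "\<bar>m - n\<bar> \<le> 1"
  shows "site_weight c m \<le> 3 * site_weight c n"
proof -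
  define d where "d = real_of_int (n - c)"
  have "m = n - 1 \<or> m = n \<or> m = n + 1" using assms by arith
  then have "real_of_int (m - c) = d - 1 \<or> real_of_int (m - c) = d \<or> real_of_int (m - c) = d + 1"
    by (auto simp: d_def)
  moreover have "(d - 1)\<^sup>2 \<le> 2 + 3 * d\<^sup>2" "(d + 1)\<^sup>2 \<le> 2 + 3 * d\<^sup>2" "d\<^sup>2 \<le> 2 + 3 * d\<^sup>2"
  proof -
    have "0 \<le> (d + 1)\<^sup>2 + d\<^sup>2" "0 \<le> (d - 1)\<^sup>2 + d\<^sup>2" "0 \<le> d\<^sup>2" by simp_all
    then show "(d - 1)\<^sup>2 \<le> 2 + 3 * d\<^sup>2" "(d + 1)\<^sup>2 \<le> 2 + 3 * d\<^sup>2" "d\<^sup>2 \<le> 2 + 3 * d\<^sup>2"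
      by (simp_all add: power2_eq_square algebra_simps)
  qed
  ultimately show ?thesis
    unfolding site_weight_def d_def[symmetric] by auto
qed

text \<open>
  The weight is not periodic, so the seam needs an argument of its own: sites \<open>1\<close> and \<open>2c\<close> have
  distances \<open>c - 1\<close> and \<open>c\<close> from the centre, and their weights are as close as those of
  neighbours.
\<close>

lemma site_weight_seam: "site_weight c (2 * c) \<le> 3 * site_weight c 1"
proof -
  define x where "x = real_of_int c"
  have "x\<^sup>2 \<le> 2 + 3 * (1 - x)\<^sup>2"
    using zero_le_power2[of "2 * x - 3"] by (simp add: power2_eq_square algebra_simps)
  then show ?thesis by (simp add: site_weight_def x_def)
qed

lemma weighted_sum_shift_right:
  assumes "c \<ge> 1" and periodic: "\<And>n. q (n + 2 * c) = q n" and nonneg: "\<And>n. (q n :: real) \<ge> 0"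
  shows "(\<Sum>n\<in>{1..2 * c}. site_weight c n * q (n + 1))
    \<le> 3 * (\<Sum>n\<in>{1..2 * c}. site_weight c n * q n)"
proof -
  have "(\<Sum>n\<in>{1..2 * c}. site_weight c n * q (n + 1))
      = (\<Sum>n\<in>{2..2 * c + 1}. site_weight c (n - 1) * q n)"
    by (rule sum.reindex_bij_witness[of _ "\<lambda>n. n - 1" "\<lambda>n. n + 1"]) auto
  also have "{2..2 * c + 1} = insert (2 * c + 1) {2..2 * c}"
    using \<open>c \<ge> 1\<close> by auto
  also have "(\<Sum>n\<in>\<dots>. site_weight c (n - 1) * q n)
      = site_weight c (2 * c) * q 1 + (\<Sum>n\<in>{2..2 * c}. site_weight c (n - 1) * q n)"
    using periodic[of 1] by (simp add: add.commute)
  also have "\<dots> \<le> 3 * site_weight c 1 * q 1 + (\<Sum>n\<in>{2..2 * c}. 3 * site_weight c n * q n)"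
    by (intro add_mono sum_mono mult_right_mono site_weight_seam site_weight_neighbour nonneg) auto
  also have "\<dots> = (\<Sum>n\<in>insert 1 {2..2 * c}. 3 * site_weight c n * q n)"
    by simp
  also have "insert 1 {2..2 * c} = {1..2 * c}"
    using \<open>c \<ge> 1\<close> by auto
  finally show ?thesis by (simp add: sum_distrib_left mult.assoc)
qed

lemma weighted_sum_shift_left:
  assumes "c \<ge> 1" and periodic: "\<And>n. q (n + 2 * c) = q n" and nonneg: "\<And>n. (q n :: real) \<ge> 0"
  shows "(\<Sum>n\<in>{1..2 * c}. site_weight c n * q (n - 1))
    \<le> 3 * (\<Sum>n\<in>{1..2 * c}. site_weight c n * q n)"
proof -
  have seam: "site_weight c 1 \<le> 3 * site_weight c (2 * c)"
  proof -
    define x where "x = real_of_int c"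
    have "0 \<le> x\<^sup>2 + (x + 1)\<^sup>2" by simp
    then have "(1 - x)\<^sup>2 \<le> 2 + 3 * x\<^sup>2" by (simp add: power2_eq_square algebra_simps)
    then show ?thesis by (simp add: site_weight_def x_def)
  qed
  have "(\<Sum>n\<in>{1..2 * c}. site_weight c n * q (n - 1))
      = (\<Sum>n\<in>{0..2 * c - 1}. site_weight c (n + 1) * q n)"
    by (rule sum.reindex_bij_witness[of _ "\<lambda>n. n + 1" "\<lambda>n. n - 1"]) auto
  also have "{0..2 * c - 1} = insert 0 {1..2 * c - 1}"
    using \<open>c \<ge> 1\<close> by auto
  also have "(\<Sum>n\<in>\<dots>. site_weight c (n + 1) * q n)
      = site_weight c 1 * q (2 * c) + (\<Sum>n\<in>{1..2 * c - 1}. site_weight c (n + 1) * q n)"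
    using periodic[of 0] by simp
  also have "\<dots> \<le> 3 * site_weight c (2 * c) * q (2 * c)
      + (\<Sum>n\<in>{1..2 * c - 1}. 3 * site_weight c n * q n)"
    by (intro add_mono sum_mono mult_right_mono seam site_weight_neighbour nonneg) auto
  also have "\<dots> = (\<Sum>n\<in>insert (2 * c) {1..2 * c - 1}. 3 * site_weight c n * q n)"
    by simp
  also have "insert (2 * c) {1..2 * c - 1} = {1..2 * c}"
    using \<open>c \<ge> 1\<close> by auto
  finally show ?thesis by (simp add: sum_distrib_left mult.assoc)
qed

section \<open>The weighted energy\<close>

text \<open>
  Right minus left is
  \<open>(v - z)\<^sup>2 + (v - h)\<^sup>2 + \<alpha> ((v - zp)\<^sup>2 + (v - zm)\<^sup>2 + 2 (v + z)\<^sup>2)\<close>.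
\<close>

lemma power_density_bound:
  fixes v z zm zp h \<alpha> :: real
  assumes "\<alpha> \<ge> 0"
  shows "2 * v * (z + \<alpha> * (zm - 2 * z + zp) + h)
    \<le> (2 + 4 * \<alpha>) * v\<^sup>2 + (1 + 2 * \<alpha>) * z\<^sup>2 + \<alpha> * zp\<^sup>2 + \<alpha> * zm\<^sup>2 + h\<^sup>2"
proof -
  have "0 \<le> (v - z)\<^sup>2 + (v - h)\<^sup>2 + \<alpha> * ((v - zp)\<^sup>2 + (v - zm)\<^sup>2 + 2 * (v + z)\<^sup>2)"
    using assms by simp
  then show ?thesis by (simp add: power2_eq_square algebra_simps)
qed

text \<open>
  The left-hand side is the time derivative, in the variable \<open>t / \<epsilon>\<close>, of the weighted energy of
  \<open>z'' = \<alpha> (z(n-1) - 2 z(n) + z(n+1)) + h(n)\<close>. Young's inequality decouples the products, and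
  the shifted squares are moved back to their own site at the price of the factor \<open>3\<close>.
\<close>

lemma lattice_energy_derivative_bound:
  fixes v z h :: "int \<Rightarrow> real"
  assumes "\<alpha> \<ge> 0" "c \<ge> 1" and periodic: "\<And>n. z (n + 2 * c) = z n"
  shows "(\<Sum>n\<in>{1..2 * c}. site_weight c n *
      (2 * v n * (z n + \<alpha> * (z (n - 1) - 2 * z n + z (n + 1)) + h n)))
    \<le> (2 + 8 * \<alpha>) * (\<Sum>n\<in>{1..2 * c}. site_weight c n * ((z n)\<^sup>2 + (v n)\<^sup>2))
      + (\<Sum>n\<in>{1..2 * c}. site_weight c n * (h n)\<^sup>2)"
    (is "?L \<le> _ * ?E + ?H")
proof -
  define S where "S q = (\<Sum>n\<in>{1..2 * c}. site_weight c n * q n)" for q :: "int \<Rightarrow> real"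
  have S_nonneg: "S q \<ge> 0" if "\<And>n. q n \<ge> 0" for q
    unfolding S_def using that by (intro sum_nonneg mult_nonneg_nonneg less_imp_le[OF site_weight_pos])
  have right: "S (\<lambda>n. (z (n + 1))\<^sup>2) \<le> 3 * S (\<lambda>n. (z n)\<^sup>2)"
    unfolding S_def by (rule weighted_sum_shift_right) (use assms in auto)
  have left: "S (\<lambda>n. (z (n - 1))\<^sup>2) \<le> 3 * S (\<lambda>n. (z n)\<^sup>2)"
    unfolding S_def by (rule weighted_sum_shift_left) (use assms in auto)
  have "?L \<le> S (\<lambda>n. (2 + 4 * \<alpha>) * (v n)\<^sup>2 + (1 + 2 * \<alpha>) * (z n)\<^sup>2
      + \<alpha> * (z (n + 1))\<^sup>2 + \<alpha> * (z (n - 1))\<^sup>2 + (h n)\<^sup>2)"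
    unfolding S_def
    by (intro sum_mono mult_left_mono power_density_bound \<open>\<alpha> \<ge> 0\<close> less_imp_le[OF site_weight_pos])
  also have "\<dots> = (2 + 4 * \<alpha>) * S (\<lambda>n. (v n)\<^sup>2) + (1 + 2 * \<alpha>) * S (\<lambda>n. (z n)\<^sup>2)
      + \<alpha> * S (\<lambda>n. (z (n + 1))\<^sup>2) + \<alpha> * S (\<lambda>n. (z (n - 1))\<^sup>2) + S (\<lambda>n. (h n)\<^sup>2)"
    by (simp add: S_def distrib_left sum.distrib sum_distrib_left mult.left_commute)
  also have "\<dots> \<le> (2 + 4 * \<alpha>) * S (\<lambda>n. (v n)\<^sup>2) + (1 + 2 * \<alpha>) * S (\<lambda>n. (z n)\<^sup>2)
      + \<alpha> * (3 * S (\<lambda>n. (z n)\<^sup>2)) + \<alpha> * (3 * S (\<lambda>n. (z n)\<^sup>2)) + S (\<lambda>n. (h n)\<^sup>2)"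
    using left right \<open>\<alpha> \<ge> 0\<close> by (intro add_mono mult_left_mono order_refl) auto
  also have "\<dots> = (2 + 4 * \<alpha>) * S (\<lambda>n. (v n)\<^sup>2) + (1 + 8 * \<alpha>) * S (\<lambda>n. (z n)\<^sup>2) + S (\<lambda>n. (h n)\<^sup>2)"
    by (simp add: algebra_simps)
  also have "\<dots> \<le> (2 + 8 * \<alpha>) * S (\<lambda>n. (v n)\<^sup>2) + (2 + 8 * \<alpha>) * S (\<lambda>n. (z n)\<^sup>2) + S (\<lambda>n. (h n)\<^sup>2)"
    using \<open>\<alpha> \<ge> 0\<close> by (intro add_mono mult_right_mono order_refl S_nonneg) auto
  also have "\<dots> = (2 + 8 * \<alpha>) * ?E + ?H"
    by (simp add: S_def distrib_left sum.distrib)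
  finally show ?thesis .
qed

text \<open>
  The total \<open>8 \<kappa>\<^sup>2\<close> is independent of \<open>N\<close>: the three forced sites have weights \<open>2, 1, 2\<close> and
  rescaled forces \<open>-\<kappa>, 2 \<kappa>, -\<kappa>\<close>. For \<open>c \<ge> 2\<close> they all lie inside the period.
\<close>

lemma weighted_ghost_force_sum:
  assumes N: "int N = 2 * c" and "c \<ge> 2"
  shows "(\<Sum>n\<in>{1..2 * c}. site_weight c n * (spacing N * ghost_force \<kappa> N n)\<^sup>2) = 8 * \<kappa>\<^sup>2"
proof -
  define F where "F n = site_weight c n * (spacing N * ghost_force \<kappa> N n)\<^sup>2" for n
  have eps: "spacing N \<noteq> 0" using assms by (auto simp: spacing_def)
  have div: "int N div 2 = c" using N by simp
  have residue: "n mod int N = (if n = 2 * c then 0 else n)" if "n \<in> {1..2 * c}" for n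
    using that N by auto
  have "(\<Sum>n\<in>{1..2 * c}. F n) = (\<Sum>n\<in>{c - 1, c, c + 1}. F n)"
  proof (rule sum.mono_neutral_right)
    show "\<forall>n\<in>{1..2 * c} - {c - 1, c, c + 1}. F n = 0"
      using \<open>c \<ge> 2\<close> residue by (auto simp: F_def ghost_force_def Let_def div)
  qed (use \<open>c \<ge> 2\<close> in auto)
  also have "\<dots> = F (c - 1) + F c + F (c + 1)" by simp
  also have "F c = 4 * \<kappa>\<^sup>2"
    using \<open>c \<ge> 2\<close> eps residue[of c]
    by (simp add: F_def ghost_force_def Let_def div site_weight_def power_mult_distrib)
  also have "F (c - 1) = 2 * \<kappa>\<^sup>2"
    using \<open>c \<ge> 2\<close> eps residue[of "c - 1"]
    by (simp add: F_def ghost_force_def Let_def div site_weight_def)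
  also have "F (c + 1) = 2 * \<kappa>\<^sup>2"
    using \<open>c \<ge> 2\<close> eps residue[of "c + 1"]
    by (simp add: F_def ghost_force_def Let_def div site_weight_def)
  finally show ?thesis by (simp add: F_def)
qed

text \<open>
  Gronwall's inequality is applied with rates \<open>K / \<epsilon>\<close> and \<open>8 \<kappa>\<^sub>2\<^sup>2 / \<epsilon>\<close>. They blow up with \<open>N\<close>,
  but enter only through their products with \<open>t \<le> T \<epsilon>\<close>.
\<close>

lemma lattice_solution_weighted_bound:
  assumes pos: "\<kappa>\<^sub>1 + 4 * \<kappa>\<^sub>2 > 0" and N: "int N = 2 * c" and "c \<ge> 2"
    and sol: "lattice_solution \<kappa>\<^sub>1 \<kappa>\<^sub>2 N y"
    and t: "0 \<le> t" "t \<le> T * spacing N" and n: "n \<in> {1..2 * c}"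
  shows "site_weight c n * (y n t / spacing N)\<^sup>2
    \<le> 8 * \<kappa>\<^sub>2\<^sup>2 * T * exp ((2 + 8 * (\<kappa>\<^sub>1 + 4 * \<kappa>\<^sub>2)) * T)"
proof -
  define \<alpha> where "\<alpha> = \<kappa>\<^sub>1 + 4 * \<kappa>\<^sub>2"
  define \<epsilon> where "\<epsilon> = spacing N"
  have \<epsilon>: "\<epsilon> > 0" using N \<open>c \<ge> 2\<close> by (auto simp: \<epsilon>_def spacing_def)
  have \<alpha>: "\<alpha> > 0" using pos by (simp add: \<alpha>_def)
  have T: "t / \<epsilon> \<le> T" "0 \<le> t / \<epsilon>" "T \<ge> 0"
  proof -
    show "t / \<epsilon> \<le> T" using t \<epsilon> by (simp add: \<epsilon>_def pos_divide_le_eq)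
    show "0 \<le> t / \<epsilon>" using t \<epsilon> by simp
    then show "T \<ge> 0" using \<open>t / \<epsilon> \<le> T\<close> by simp
  qed
  from sol obtain v a where
    periodic: "\<And>n t. t \<ge> 0 \<Longrightarrow> y (n + 2 * c) t = y n t"
    and y': "\<And>n t. t \<ge> 0 \<Longrightarrow> (y n has_real_derivative v n t) (at t within {0..})"
    and v': "\<And>n t. t \<ge> 0 \<Longrightarrow> (v n has_real_derivative a n t) (at t within {0..})"
    and eq: "\<And>n t. t \<ge> 0 \<Longrightarrow>
      a n t - \<alpha> / \<epsilon>\<^sup>2 * (y (n - 1) t - 2 * y n t + y (n + 1) t) = ghost_force \<kappa>\<^sub>2 N n"
    and init: "\<And>n. y n 0 = 0" "\<And>n. v n 0 = 0"
    unfolding lattice_solution_def N \<alpha>_def[symmetric] \<epsilon>_def[symmetric] by blast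
  define K where "K = 2 + 8 * \<alpha>"
  define E where "E s = (\<Sum>n\<in>{1..2 * c}. site_weight c n * ((y n s / \<epsilon>)\<^sup>2 + (v n s)\<^sup>2))" for s
  define E' where "E' s = (\<Sum>n\<in>{1..2 * c}. site_weight c n *
    (2 * (y n s / \<epsilon>) * (v n s / \<epsilon>) + 2 * v n s * a n s))" for s
  have E_deriv: "(E has_real_derivative E' s) (at s within {0..})" if "s \<ge> 0" for s
    unfolding E_def E'_def
  proof (intro DERIV_sum DERIV_cmult DERIV_add)
    fix n
    have "((\<lambda>s. (y n s / \<epsilon>)\<^sup>2) has_real_derivative real 2 * (v n s / \<epsilon> * (y n s / \<epsilon>) ^ (2 - Suc 0)))
        (at s within {0..})"
      by (intro DERIV_power DERIV_cdivide y' that)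
    then show "((\<lambda>s. (y n s / \<epsilon>)\<^sup>2) has_real_derivative 2 * (y n s / \<epsilon>) * (v n s / \<epsilon>))
        (at s within {0..})"
      by (simp add: mult_ac)
    have "((\<lambda>s. (v n s)\<^sup>2) has_real_derivative real 2 * (a n s * v n s ^ (2 - Suc 0)))
        (at s within {0..})"
      by (intro DERIV_power v' that)
    then show "((\<lambda>s. (v n s)\<^sup>2) has_real_derivative 2 * v n s * a n s) (at s within {0..})"
      by (simp add: mult_ac)
  qed
  have E'_bound: "E' s \<le> K / \<epsilon> * E s + 8 * \<kappa>\<^sub>2\<^sup>2 / \<epsilon>" if "s \<ge> 0" for s
  proof -
    define z where "z n = y n s / \<epsilon>" for n
    have term_eq: "\<epsilon> * (2 * (y n s / \<epsilon>) * (v n s / \<epsilon>) + 2 * v n s * a n s)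
        = 2 * v n s * (z n + \<alpha> * (z (n - 1) - 2 * z n + z (n + 1)) + \<epsilon> * ghost_force \<kappa>\<^sub>2 N n)" for n
    proof -
      have acc: "a n s = \<alpha> / \<epsilon>\<^sup>2 * (y (n - 1) s - 2 * y n s + y (n + 1) s) + ghost_force \<kappa>\<^sub>2 N n"
        using eq[OF that, of n] by simp
      show ?thesis
        unfolding acc z_def using \<epsilon> by (simp add: field_simps power2_eq_square)
    qed
    have "\<epsilon> * E' s = (\<Sum>n\<in>{1..2 * c}. site_weight c n *
        (2 * v n s * (z n + \<alpha> * (z (n - 1) - 2 * z n + z (n + 1)) + \<epsilon> * ghost_force \<kappa>\<^sub>2 N n)))"
      unfolding E'_def sum_distrib_left term_eq[symmetric] by (simp add: mult.left_commute)
    also have "\<dots> \<le> (2 + 8 * \<alpha>) * (\<Sum>n\<in>{1..2 * c}. site_weight c n * ((z n)\<^sup>2 + (v n s)\<^sup>2))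
        + (\<Sum>n\<in>{1..2 * c}. site_weight c n * (\<epsilon> * ghost_force \<kappa>\<^sub>2 N n)\<^sup>2)"
      by (rule lattice_energy_derivative_bound)
        (use \<alpha> \<open>c \<ge> 2\<close> periodic[OF that] in \<open>auto simp: z_def\<close>)
    also have "\<dots> = K * E s + 8 * \<kappa>\<^sub>2\<^sup>2"
      unfolding \<epsilon>_def weighted_ghost_force_sum[OF N \<open>c \<ge> 2\<close>]
      by (simp add: E_def K_def z_def \<epsilon>_def)
    finally show ?thesis using \<epsilon> by (simp add: field_simps)
  qed
  have "site_weight c n * (y n t / \<epsilon>)\<^sup>2 \<le> site_weight c n * ((y n t / \<epsilon>)\<^sup>2 + (v n t)\<^sup>2)"
    by (intro mult_left_mono less_imp_le[OF site_weight_pos]) auto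
  also have "\<dots> \<le> E t"
    unfolding E_def using n
    by (intro member_le_sum mult_nonneg_nonneg less_imp_le[OF site_weight_pos]) auto
  also have "E t \<le> (E 0 + 8 * \<kappa>\<^sub>2\<^sup>2 / \<epsilon> * t) * exp (K / \<epsilon> * t)"
    by (rule linear_gronwall[OF E_deriv E'_bound]) (use \<alpha> \<epsilon> t in \<open>auto simp: K_def\<close>)
  also have "\<dots> = 8 * \<kappa>\<^sub>2\<^sup>2 * (t / \<epsilon>) * exp (K * (t / \<epsilon>))"
    by (simp add: E_def init)
  also have "\<dots> \<le> 8 * \<kappa>\<^sub>2\<^sup>2 * T * exp (K * T)"
  proof -
    have "K \<ge> 0" using \<alpha> by (simp add: K_def)
    then have "exp (K * (t / \<epsilon>)) \<le> exp (K * T)"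
      using T by (simp add: mult_left_mono del: times_divide_eq_right)
    then show ?thesis using T by (intro mult_mono) auto
  qed
  finally show ?thesis by (simp add: K_def \<alpha>_def \<epsilon>_def)
qed

section \<open>Pointwise decay\<close>

text \<open>
  Here \<open>r\<close> will be the distance of the bond between \<open>n\<close> and \<open>n + 1\<close> from the centre. The factor \<open>4\<close>
  leaves room for the weights at both ends of the bond, also when the right end wraps around
  to site \<open>1\<close>.
\<close>

lemma abs_le_of_weighted_bound:
  fixes w x B r :: real
  assumes bound: "w * x\<^sup>2 \<le> B\<^sup>2" and r: "0 < r" "r\<^sup>2 \<le> 4 * w" and "B \<ge> 0"
  shows "\<bar>x\<bar> \<le> 2 * B / r"
proof -
  have "r\<^sup>2 * x\<^sup>2 \<le> 4 * w * x\<^sup>2"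
    using r by (intro mult_right_mono) auto
  also have "\<dots> \<le> (2 * B)\<^sup>2" using bound by (simp add: power_mult_distrib)
  finally have "(r * \<bar>x\<bar>)\<^sup>2 \<le> (2 * B)\<^sup>2" by (simp add: power_mult_distrib)
  then have "r * \<bar>x\<bar> \<le> 2 * B"
    by (rule power2_le_imp_le) (simp add: \<open>B \<ge> 0\<close>)
  then show ?thesis
    unfolding pos_le_divide_eq[OF r(1)] by (subst mult.commute)
qed

lemma inverse_le_powr_two_thirds:
  fixes r :: real
  assumes "r \<ge> 1 / 2"
  shows "1 / r \<le> 2 * r powr (- (2 / 3))"
proof -
  have "r powr (- (1 / 3)) \<le> (1 / 2) powr (- (1 / 3))"
    using assms by (intro powr_mono2') auto
  also have "\<dots> = 2 powr (1 / 3)"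
    by (simp add: powr_minus powr_divide)
  also have "\<dots> \<le> 2 powr 1"
    by (intro powr_mono) auto
  finally have third: "r powr (- (1 / 3)) \<le> 2" by simp
  have "1 / r = r powr (- (1 / 3) + - (2 / 3))"
    using assms by (simp add: powr_minus_divide)
  also have "\<dots> = r powr (- (1 / 3)) * r powr (- (2 / 3))"
    by (rule powr_add)
  also have "\<dots> \<le> 2 * r powr (- (2 / 3))"
    using third by (rule mult_right_mono) simp
  finally show ?thesis .
qed

section \<open>The gradient estimate\<close>

theorem lemma6p1:
  fixes \<kappa>\<^sub>1 \<kappa>\<^sub>2 T :: real
  assumes "\<kappa>\<^sub>1 + 4 * \<kappa>\<^sub>2 > 0" and "T > 0"
  shows "\<exists>C>0. \<forall>N::nat. even N \<and> N \<ge> 4 \<longrightarrow>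
    (\<forall>y. lattice_solution \<kappa>\<^sub>1 \<kappa>\<^sub>2 N y \<longrightarrow>
      (\<forall>t n. 0 \<le> t \<and> t \<le> T * spacing N \<and> n \<in> {1..int N} \<and>
             n \<noteq> int N div 2 \<and> n \<noteq> int N div 2 - 1 \<longrightarrow>
        \<bar>discrete_gradient N y n t\<bar> \<le>
          C * (\<bar>\<kappa>\<^sub>2\<bar> / (\<kappa>\<^sub>1 + 4 * \<kappa>\<^sub>2)) *
          (\<bar>real_of_int n + 1 / 2 - real N / 2\<bar> powr (- (2 / 3)) + spacing N powr (2 / 3))))"
proof -
  define \<alpha> where "\<alpha> = \<kappa>\<^sub>1 + 4 * \<kappa>\<^sub>2"
  define D where "D = sqrt (8 * T * exp ((2 + 8 * \<alpha>) * T))"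
  have \<alpha>: "\<alpha> > 0" using assms by (simp add: \<alpha>_def)
  have D: "D > 0" using \<open>T > 0\<close> by (simp add: D_def)
  have main: "\<bar>discrete_gradient N y n t\<bar>
      \<le> 8 * D * \<alpha> * (\<bar>\<kappa>\<^sub>2\<bar> / \<alpha>) *
        (\<bar>real_of_int n + 1 / 2 - real N / 2\<bar> powr (- (2 / 3)) + spacing N powr (2 / 3))"
    if "even N" "N \<ge> 4" and sol: "lattice_solution \<kappa>\<^sub>1 \<kappa>\<^sub>2 N y"
      and t: "0 \<le> t" "t \<le> T * spacing N" and n: "n \<in> {1..int N}"
    for N y t n
  proof -
    define c where "c = int N div 2"
    have N: "int N = 2 * c" using \<open>even N\<close> by (simp add: c_def)
    have c: "c \<ge> 2" using N \<open>N \<ge> 4\<close> by simp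
    define x where "x = real_of_int (n - c)"
    define r where "r = \<bar>x + 1 / 2\<bar>"
    have "real N = 2 * real_of_int c"
      using N by (metis of_int_mult of_int_numeral of_int_of_nat_eq)
    then have r_eq: "\<bar>real_of_int n + 1 / 2 - real N / 2\<bar> = r"
      by (simp add: r_def x_def)
    \<comment> \<open>A half-integer is never smaller than \<open>1/2\<close> in absolute value.\<close>
    have "x \<ge> 0 \<or> x \<le> -1"
    proof -
      have "n - c \<ge> 0 \<or> n - c \<le> -1" by arith
      then show ?thesis unfolding x_def by linarith
    qed
    then have r: "r \<ge> 1 / 2" unfolding r_def by arith
    have site_bound: "\<bar>y m t / spacing N\<bar> \<le> 2 * (D * \<bar>\<kappa>\<^sub>2\<bar>) / r"
      if m: "m \<in> {1..2 * c}" and weight: "r\<^sup>2 \<le> 4 * site_weight c m" for m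
    proof (rule abs_le_of_weighted_bound[OF _ _ weight])
      have "(D * \<bar>\<kappa>\<^sub>2\<bar>)\<^sup>2 = 8 * \<kappa>\<^sub>2\<^sup>2 * T * exp ((2 + 8 * \<alpha>) * T)"
        using \<open>T > 0\<close> by (simp add: D_def power_mult_distrib)
      then show "site_weight c m * (y m t / spacing N)\<^sup>2 \<le> (D * \<bar>\<kappa>\<^sub>2\<bar>)\<^sup>2"
        using lattice_solution_weighted_bound[OF assms(1) N c sol t m] by (simp add: \<alpha>_def)
    qed (use r D in auto)
    have here: "\<bar>y n t / spacing N\<bar> \<le> 2 * (D * \<bar>\<kappa>\<^sub>2\<bar>) / r"
    proof (rule site_bound)
      have "(x + 1 / 2)\<^sup>2 \<le> 4 * (1 + x\<^sup>2)"
      proof -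
        have "0 \<le> 2 * x\<^sup>2 + (x - 1 / 2)\<^sup>2 + 7 / 2" by simp
        then show ?thesis by (simp add: power2_eq_square algebra_simps)
      qed
      then show "r\<^sup>2 \<le> 4 * site_weight c n" by (simp add: r_def site_weight_def x_def)
    qed (use n N in auto)
    have "next": "\<bar>y (n + 1) t / spacing N\<bar> \<le> 2 * (D * \<bar>\<kappa>\<^sub>2\<bar>) / r"
    proof (cases "n = 2 * c")
      case False
      show ?thesis
      proof (rule site_bound)
        have "(x + 1 / 2)\<^sup>2 \<le> 4 * (1 + (x + 1)\<^sup>2)"
        proof -
          have "0 \<le> 3 * (x + 7 / 6)\<^sup>2 + 11 / 3" by simp
          then show ?thesis by (simp add: power2_eq_square algebra_simps)
        qed
        moreover have "real_of_int (n + 1 - c) = x + 1" by (simp add: x_def)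
        ultimately show "r\<^sup>2 \<le> 4 * site_weight c (n + 1)"
          unfolding r_def site_weight_def by (simp only: power2_abs)
      qed (use n N False in auto)
    next
      case True
      \<comment> \<open>The right neighbour of site \<open>N\<close> is site \<open>1\<close>, at distance \<open>c - 1\<close> from the centre.\<close>
      have "y (1 + int N) t = y 1 t"
        using sol t unfolding lattice_solution_def by blast
      then have wrap: "y (n + 1) t = y 1 t"
        using True N by (simp add: add.commute)
      show ?thesis unfolding wrap
      proof (rule site_bound)
        have x: "x = real_of_int c" using True by (simp add: x_def)
        have "(x + 1 / 2)\<^sup>2 \<le> 4 * (1 + (1 - x)\<^sup>2)"
        proof -
          have "0 \<le> 3 * (x - 3 / 2)\<^sup>2 + 1" by simp
          then show ?thesis by (simp add: power2_eq_square algebra_simps)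
        qed
        then show "r\<^sup>2 \<le> 4 * site_weight c 1" by (simp add: r_def site_weight_def x)
      qed (use c in auto)
    qed
    have "\<bar>discrete_gradient N y n t\<bar> = \<bar>y (n + 1) t / spacing N - y n t / spacing N\<bar>"
      by (simp add: discrete_gradient_def diff_divide_distrib)
    also have "\<dots> \<le> 4 * (D * \<bar>\<kappa>\<^sub>2\<bar>) * (1 / r)"
      using abs_triangle_ineq4[of "y (n + 1) t / spacing N" "y n t / spacing N"] here "next" by simp
    also have "\<dots> \<le> 4 * (D * \<bar>\<kappa>\<^sub>2\<bar>) * (2 * r powr (- (2 / 3)))"
      using D inverse_le_powr_two_thirds[OF r] by (intro mult_left_mono) auto
    also have "\<dots> = 8 * D * \<alpha> * (\<bar>\<kappa>\<^sub>2\<bar> / \<alpha>) * r powr (- (2 / 3))"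
      using \<alpha> by simp
    also have "\<dots> \<le> 8 * D * \<alpha> * (\<bar>\<kappa>\<^sub>2\<bar> / \<alpha>) * (r powr (- (2 / 3)) + spacing N powr (2 / 3))"
      using D \<alpha> by (intro mult_left_mono) auto
    finally show ?thesis unfolding r_eq .
  qed
  show ?thesis
    unfolding \<alpha>_def[symmetric]
    by (rule exI[of _ "8 * D * \<alpha>"]) (use main D \<alpha> in auto)
qed

end
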